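(* Let $r\ge 1$. Assume that $a_j>0$ is a real number and $d_j$ is a natural number or $\infty$, $1\le d_j\le\infty$, for all $1\le j\le r$, and put $\boldsymbol a=(a_1,\dots,a_r)$, $\boldsymbol d=(d_1,\dots,d_r)$. Then the conditional infimum $M(\boldsymbol d,\boldsymbol a)$ coincides with the minimal solution $\lambda$ of $$\sum_{j=1}^r\frac{d_j}{a_jd_j+a_j-\lambda}=\frac1\lambda .$$
   Context: For $\boldsymbol a$ and $\boldsymbol d$ as in the claim, let $$\phi(x_0,\boldsymbol x)=\phi(x_0,\boldsymbol x_1,\dots,\boldsymbol x_r)=\sum_{j=1}^r a_j\left(\langle\boldsymbol x_j,\boldsymbol x_j\rangle+\langle\mathbf 1_j,\boldsymbol x_j\rangle^2\right),$$ where $x_0\in\mathbb R$, $\boldsymbol x_j\in\mathbb R^{d_j}$, $\mathbf 1_j\in\mathbb R^{d_j}$ is the all-ones vector and $\langle\cdot,\cdot\rangle$ is the canonical inner product. If $d_j=\infty$, $\boldsymbol x_j$ ranges over real sequences with finite support (so all sums are finite). $M(\boldsymbol d,\boldsymbol a)$ is the infimum of $\phi(x_0,\boldsymbol x)$ over all such $(x_0,\boldsymbol x)$ satisfying $$x_0^2+\sum_{j=1}^r\langle\boldsymbol x_j,\boldsymbol x_j\rangle=1,\qquad x_0+\sum_{j=1}^r\langle\mathbf 1_j,\boldsymbol x_j\rangle=0.$$ Convention in the equation: if $d_j=\infty$, the term $\frac{d_j}{a_jd_j+a_j-\lambda}$ is understood as $\frac1{a_j}$. The minimal solution is the smallest real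 $\lambda$ (with $\lambda\neq0$ and no denominator vanishing) satisfying the equation. *)

theory Defs
  imports Complex_Main "HOL-Library.Extended_Nat" "HOL-Library.Groups_Big_Fun"
begin

text \<open>
  For \<open>n\<close> finite, \<open>vecs n\<close> is the space of real vectors of length \<open>n\<close>, encoded as functions on
  \<open>nat\<close> that vanish from index \<open>n\<close> on; for \<open>n = \<infinity>\<close> it is the space of real sequences with finite
  support.
\<close>

definition vecs :: "enat \<Rightarrow> (nat \<Rightarrow> real) set" where
  "vecs n = {u. finite {i. u i \<noteq> 0} \<and> (\<forall>i. \<not> enat i < n \<longrightarrow> u i = 0)}"

text \<open>
  \<open>Sum_any\<close> is the sum over the support of the summand. For \<open>n = \<infinity>\<close> the vector \<open>ones n\<close> is not in
  \<open>vecs n\<close>, but its products with elements of \<open>vecs n\<close> still have finite support.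
\<close>

definition ones :: "enat \<Rightarrow> nat \<Rightarrow> real" where
  "ones n = (\<lambda>i. if enat i < n then 1 else 0)"

definition ip :: "(nat \<Rightarrow> real) \<Rightarrow> (nat \<Rightarrow> real) \<Rightarrow> real" where
  "ip u v = Sum_any (\<lambda>i. u i * v i)"

definition phi ::
  "nat \<Rightarrow> (nat \<Rightarrow> enat) \<Rightarrow> (nat \<Rightarrow> real) \<Rightarrow> real \<Rightarrow> (nat \<Rightarrow> nat \<Rightarrow> real) \<Rightarrow> real" where
  "phi r d a x0 x = (\<Sum>j=1..r. a j * (ip (x j) (x j) + (ip (ones (d j)) (x j))\<^sup>2))"

definition feasible :: "nat \<Rightarrow> (nat \<Rightarrow> enat) \<Rightarrow> (real \<times> (nat \<Rightarrow> nat \<Rightarrow> real)) set" where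
  "feasible r d = {(x0, x).
     (\<forall>j\<in>{1..r}. x j \<in> vecs (d j)) \<and>
     x0\<^sup>2 + (\<Sum>j=1..r. ip (x j) (x j)) = 1 \<and>
     x0 + (\<Sum>j=1..r. ip (ones (d j)) (x j)) = 0}"

text \<open>
  If \<open>r \<ge> 1\<close> and all \<open>d j \<ge> 1\<close>, \<open>a j > 0\<close>, the set below is nonempty and bounded below by \<open>0\<close>,
  so that \<open>Inf\<close> is the true infimum.
\<close>

definition cond_inf :: "nat \<Rightarrow> (nat \<Rightarrow> enat) \<Rightarrow> (nat \<Rightarrow> real) \<Rightarrow> real" where
  "cond_inf r d a = Inf {phi r d a x0 x |x0 x. (x0, x) \<in> feasible r d}"

definition eq_term :: "enat \<Rightarrow> real \<Rightarrow> real \<Rightarrow> real" where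
  "eq_term n \<alpha> l = (case n of enat m \<Rightarrow> real m / (\<alpha> * real m + \<alpha> - l) | \<infinity> \<Rightarrow> 1 / \<alpha>)"

definition is_solution :: "nat \<Rightarrow> (nat \<Rightarrow> enat) \<Rightarrow> (nat \<Rightarrow> real) \<Rightarrow> real \<Rightarrow> bool" where
  "is_solution r d a l \<longleftrightarrow>
     l \<noteq> 0 \<and>
     (\<forall>j\<in>{1..r}. \<forall>m. d j = enat m \<longrightarrow> a j * real m + a j - l \<noteq> 0) \<and>
     (\<Sum>j=1..r. eq_term (d j) (a j) l) = 1 / l"

definition is_minimal_solution :: "nat \<Rightarrow> (nat \<Rightarrow> enat) \<Rightarrow> (nat \<Rightarrow> real) \<Rightarrow> real \<Rightarrow> bool" where
  "is_minimal_solution r d a l \<longleftrightarrow>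
     is_solution r d a l \<and> (\<forall>l'. is_solution r d a l' \<longrightarrow> l \<le> l')"

end

theory Submission imports Defs begin

text \<open>
  Write \<open>t\<^sub>j(\<lambda>)\<close> for the \<open>j\<close>-th term of the equation, and \<open>s\<^sub>j\<close> for the sum of the entries of the
  block \<open>x\<^sub>j\<close>. The linear constraint eliminates \<open>x\<^sub>0 = - (\<Sum> s\<^sub>j)\<close>, so that \<open>\<phi> \<ge> \<lambda>\<close> on the feasible
  set says that the quadratic form
  \<open>(\<Sum>\<^sub>j (a\<^sub>j - \<lambda>) |x\<^sub>j|\<^sup>2 + a\<^sub>j s\<^sub>j\<^sup>2) - \<lambda> (\<Sum>\<^sub>j s\<^sub>j)\<^sup>2\<close> is nonnegative.

  As long as \<open>\<lambda> \<le> a\<^sub>j\<close>, the Cauchy-Schwarz inequality \<open>s\<^sub>j\<^sup>2 \<le> d\<^sub>j |x\<^sub>j|\<^sup>2\<close> turns the \<open>j\<close>-th summand into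
  at least \<open>s\<^sub>j\<^sup>2 / t\<^sub>j(\<lambda>)\<close>; this is where the terms of the equation come from
  (\<open>block_form_ge\<close>). A second application of Cauchy-Schwarz, now over the blocks, bounds
  \<open>\<Sum>\<^sub>j s\<^sub>j\<^sup>2 / t\<^sub>j\<close> below by \<open>(\<Sum>\<^sub>j s\<^sub>j)\<^sup>2 / (\<Sum>\<^sub>j t\<^sub>j)\<close>, which is \<open>\<lambda> (\<Sum>\<^sub>j s\<^sub>j)\<^sup>2\<close> because \<open>\<lambda>\<close> solves
  the equation (\<open>phi_ge\<close>). Equality holds throughout for constant blocks with \<open>s\<^sub>j = t\<^sub>j\<close>. A block of
  infinite dimension has no nonzero constant vectors, but those constant on the first \<open>N\<close> entries
  exceed the bound only by \<open>O(1/N)\<close>, so \<open>\<lambda>\<close> is still the infimum (\<open>phi_approx\<close>).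

  A solution with \<open>0 < \<lambda> \<le> min a\<^sub>j\<close> exists by the intermediate value theorem: \<open>\<lambda> (\<Sum>\<^sub>j t\<^sub>j(\<lambda>))\<close> is
  \<open>0\<close> at \<open>0\<close>, and at \<open>\<lambda> = a\<^sub>k = min a\<^sub>j\<close> the single summand \<open>t\<^sub>k(a\<^sub>k) = 1 / a\<^sub>k\<close> already makes it at
  least \<open>1\<close> (\<open>solution_exists\<close>). It is the smallest solution because each \<open>t\<^sub>j\<close> is nondecreasing
  below \<open>min a\<^sub>j\<close> while \<open>1/\<lambda>\<close> is decreasing on the positive reals, and a negative
  number is no solution, since it makes all \<open>t\<^sub>j\<close> positive (\<open>solution_minimal\<close>).
\<close>

section \<open>Inner products on finitely supported sequences\<close>

lemma ip_eq_sum: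
  assumes "finite A" "\<And>i. i \<notin> A \<Longrightarrow> u i * v i = 0"
  shows "ip u v = (\<Sum>i\<in>A. u i * v i)"
  unfolding ip_def by (rule Sum_any.expand_superset) (use assms in auto)

lemma ip_self_nonneg: "0 \<le> ip u u"
  unfolding ip_def Sum_any.expand_set by (intro sum_nonneg) simp

lemma vecs_inner_products:
  assumes "u \<in> vecs n"
  obtains A where "finite A" "\<And>i. i \<in> A \<Longrightarrow> enat i < n"
    "ip u u = (\<Sum>i\<in>A. (u i)\<^sup>2)" "ip (ones n) u = (\<Sum>i\<in>A. u i)"
proof
  let ?A = "{i. u i \<noteq> 0}"
  show fin: "finite ?A" using assms by (simp add: vecs_def)
  show supp: "enat i < n" if "i \<in> ?A" for i using assms that by (auto simp: vecs_def)
  show "ip u u = (\<Sum>i\<in>?A. (u i)\<^sup>2)"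
    by (subst ip_eq_sum[OF fin]) (auto simp: power2_eq_square)
  show "ip (ones n) u = (\<Sum>i\<in>?A. u i)"
    by (subst ip_eq_sum[OF fin]) (use supp in \<open>auto simp: ones_def intro!: sum.cong\<close>)
qed

lemma vecs_cauchy_schwarz:
  assumes "u \<in> vecs (enat m)" "m > 0"
  shows "(ip (ones (enat m)) u)\<^sup>2 / real m \<le> ip u u"
proof -
  obtain A where A: "finite A" "\<And>i. i \<in> A \<Longrightarrow> enat i < enat m"
    "ip u u = (\<Sum>i\<in>A. (u i)\<^sup>2)" "ip (ones (enat m)) u = (\<Sum>i\<in>A. u i)"
    using vecs_inner_products[OF assms(1)] by blast
  let ?s = "ip (ones (enat m)) u"
  define c where "c = ?s / m"
  have "card A \<le> card {..<m}"
    using A(2) by (intro card_mono) auto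
  then have card: "c\<^sup>2 * card A \<le> c\<^sup>2 * m"
    by (intro mult_left_mono) auto
  \<comment> \<open>The square of the deviation of \<open>u\<close> from its mean value \<open>c\<close> is nonnegative.\<close>
  have "0 \<le> (\<Sum>i\<in>A. (u i - c)\<^sup>2)" by (intro sum_nonneg) simp
  also have "\<dots> = ip u u - 2 * c * ?s + c\<^sup>2 * card A"
    unfolding A(3,4) power2_diff by (simp add: sum.distrib sum_subtractf sum_distrib_left[symmetric] sum_distrib_right[symmetric] mult_ac)
  finally have "2 * c * ?s - c\<^sup>2 * m \<le> ip u u" using card by linarith
  moreover have "2 * c * ?s - c\<^sup>2 * m = ?s\<^sup>2 / m"
    using assms(2) by (simp add: c_def power2_eq_square field_simps)
  ultimately show ?thesis by simp
qed

definition const_vec :: "nat \<Rightarrow> real \<Rightarrow> nat \<Rightarrow> real" where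
  "const_vec n c = (\<lambda>i. if i < n then c else 0)"

lemma const_vec_in_vecs:
  assumes "enat n \<le> e"
  shows "const_vec n c \<in> vecs e"
proof -
  have "finite {i. const_vec n c i \<noteq> 0}"
    by (rule finite_subset[of _ "{..<n}"]) (auto simp: const_vec_def split: if_splits)
  moreover have "enat i < e" if "i < n" for i
    using assms that by (meson enat_ord_simps(2) less_le_trans)
  ultimately show ?thesis by (auto simp: vecs_def const_vec_def)
qed

lemma ip_const_vec: "ip (const_vec n c) (const_vec n c) = n * c\<^sup>2"
  by (subst ip_eq_sum[of "{..<n}"]) (auto simp: const_vec_def power2_eq_square)

lemma ip_ones_const_vec:
  assumes "enat n \<le> e"
  shows "ip (ones e) (const_vec n c) = n * c"
proof -
  have "enat i < e" if "i < n" for i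
    using assms that by (meson enat_ord_simps(2) less_le_trans)
  then show ?thesis
    by (subst ip_eq_sum[of "{..<n}"]) (auto simp: const_vec_def ones_def)
qed

section \<open>The terms of the equation\<close>

text \<open>
  Up to \<open>\<lambda> = a\<^sub>j\<close> the terms behave well, because the pole of the \<open>j\<close>-th term, if any, is at
  \<open>a\<^sub>j (d\<^sub>j + 1) > a\<^sub>j\<close>.
\<close>

lemma eq_term_denom_pos:
  fixes \<alpha> l :: real
  assumes "\<alpha> > 0" "l \<le> \<alpha>" "m > 0"
  shows "\<alpha> * real m + \<alpha> - l > 0"
  using assms by (simp add: add_pos_nonneg add_diff_eq[symmetric])

lemma enat_ge_1_cases:
  assumes "(n::enat) \<ge> 1"
  obtains m where "n = enat m" "m > 0" | "n = \<infinity>"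
  using assms by (cases n) (auto simp: one_enat_def)

lemma eq_term_pos:
  assumes "\<alpha> > 0" "n \<ge> 1" "l \<le> \<alpha>"
  shows "eq_term n \<alpha> l > 0"
  using assms(2) assms(1,3)
  by (cases rule: enat_ge_1_cases) (auto simp: eq_term_def intro!: divide_pos_pos eq_term_denom_pos)

lemma eq_term_at_coefficient:
  assumes "\<alpha> > 0" "n \<ge> 1"
  shows "eq_term n \<alpha> \<alpha> = 1 / \<alpha>"
  using assms(2) assms(1) by (cases rule: enat_ge_1_cases) (auto simp: eq_term_def)

lemma eq_term_mono:
  assumes "\<alpha> > 0" "n \<ge> 1" "l' \<le> l" "l \<le> \<alpha>"
  shows "eq_term n \<alpha> l' \<le> eq_term n \<alpha> l"
  using assms(2)
proof (cases rule: enat_ge_1_cases)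
  case (1 m)
  then show ?thesis
    using eq_term_denom_pos[OF assms(1,4) 1(2)] assms(3)
    by (auto simp: eq_term_def intro!: divide_left_mono mult_pos_pos)
qed (simp add: eq_term_def)

lemma continuous_on_eq_term:
  assumes "\<alpha> > 0" "n \<ge> 1" "S \<subseteq> {..\<alpha>}"
  shows "continuous_on S (eq_term n \<alpha>)"
  using assms(2)
proof (cases rule: enat_ge_1_cases)
  case (1 m)
  have "\<alpha> * real m + \<alpha> - l \<noteq> 0" if "l \<in> S" for l
    using eq_term_denom_pos[of \<alpha> l m] assms 1 that by fastforce
  then show ?thesis
    unfolding eq_term_def 1 by (auto intro!: continuous_intros)
qed (simp add: eq_term_def)

text \<open>
  For finite dimension \<open>m\<close> this is Cauchy-Schwarz, since \<open>(\<alpha> - l) / m + \<alpha>\<close> is the reciprocal of the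
  term of the equation. In infinite dimension the norm of a vector is not controlled by the sum
  of its entries and only \<open>\<alpha> s\<^sup>2\<close> remains, which is the convention for the term in that case.
\<close>

lemma block_form_ge:
  assumes "\<alpha> > 0" "n \<ge> 1" "l \<le> \<alpha>" "u \<in> vecs n"
  shows "(ip (ones n) u)\<^sup>2 / eq_term n \<alpha> l \<le> (\<alpha> - l) * ip u u + \<alpha> * (ip (ones n) u)\<^sup>2"
  using assms(2)
proof (cases rule: enat_ge_1_cases)
  case (1 m)
  let ?s = "ip (ones n) u"
  have "?s\<^sup>2 / eq_term n \<alpha> l = (\<alpha> - l) * (?s\<^sup>2 / m) + \<alpha> * ?s\<^sup>2"
    using 1 eq_term_denom_pos[OF assms(1,3) 1(2)] by (simp add: eq_term_def field_simps)
  also have "(\<alpha> - l) * (?s\<^sup>2 / m) \<le> (\<alpha> - l) * ip u u"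
    using vecs_cauchy_schwarz[of u m] assms 1 by (intro mult_left_mono) auto
  finally show ?thesis by simp
next
  case 2
  then show ?thesis using assms ip_self_nonneg[of u] by (simp add: eq_term_def mult.commute)
qed

definition cutoff :: "nat \<Rightarrow> enat \<Rightarrow> nat" where
  "cutoff N n = (case n of enat m \<Rightarrow> m | \<infinity> \<Rightarrow> N)"

lemma cutoff_le: "enat (cutoff N n) \<le> n"
  by (cases n) (auto simp: cutoff_def)

lemma cutoff_pos: "n \<ge> 1 \<Longrightarrow> N > 0 \<Longrightarrow> cutoff N n > 0"
  by (erule enat_ge_1_cases) (auto simp: cutoff_def)

text \<open>
  The constant vector with entry sum \<open>eq_term n \<alpha> l\<close>, spread over \<open>N\<close> entries if \<open>n = \<infinity>\<close>, attains the
  bound of \<open>block_form_ge\<close> up to an error of order \<open>1/N\<close>.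
\<close>

lemma const_block_form:
  assumes "\<alpha> > 0" "n \<ge> 1" "l \<le> \<alpha>" "N > 0"
  defines "t \<equiv> eq_term n \<alpha> l"
  shows "(\<alpha> - l) * (t\<^sup>2 / cutoff N n) + \<alpha> * t\<^sup>2 \<le> t + (\<alpha> - l) * t\<^sup>2 / N"
  using assms(2)
proof (cases rule: enat_ge_1_cases)
  case (1 m)
  have "(\<alpha> - l) * (t\<^sup>2 / m) + \<alpha> * t\<^sup>2 = t * (t * ((\<alpha> * m + \<alpha> - l) / m))"
    using 1 by (simp add: field_simps power2_eq_square)
  also have "t * ((\<alpha> * m + \<alpha> - l) / m) = 1"
    using 1 eq_term_denom_pos[OF assms(1,3) 1(2)] by (simp add: t_def eq_term_def)
  finally show ?thesis using 1 assms by (simp add: cutoff_def)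
next
  case 2
  then show ?thesis using assms by (simp add: cutoff_def t_def eq_term_def power2_eq_square)
qed

section \<open>Existence and minimality of the solution\<close>

text \<open>
  Together with positivity, the bound \<open>l \<le> a j\<close> is what makes the lower bound for \<open>phi\<close> work: it
  expresses that the parts of the blocks orthogonal to the constants do not reach below \<open>l\<close>.
\<close>

lemma solution_exists:
  assumes "r \<ge> 1" and a: "\<And>j. j \<in> {1..r} \<Longrightarrow> a j > 0" and d: "\<And>j. j \<in> {1..r} \<Longrightarrow> d j \<ge> 1"
  obtains l where "is_solution r d a l" "l > 0" "\<And>j. j \<in> {1..r} \<Longrightarrow> l \<le> a j"
proof -
  have "Min (a ` {1..r}) \<in> a ` {1..r}" using assms(1) by (intro Min_in) auto
  then obtain k where k: "k \<in> {1..r}" "a k = Min (a ` {1..r})" by fastforce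
  have kmin: "a k \<le> a j" if "j \<in> {1..r}" for j unfolding k(2) using that by simp
  define g where "g = (\<lambda>l. l * (\<Sum>j=1..r. eq_term (d j) (a j) l))"
  have cont: "continuous_on {0..a k} g"
    unfolding g_def using kmin
    by (intro continuous_intros continuous_on_eq_term a d) (auto intro: order_trans)
  have "eq_term (d k) (a k) (a k) \<le> (\<Sum>j=1..r. eq_term (d j) (a j) (a k))"
    using k(1) by (intro member_le_sum) (auto intro!: less_imp_le eq_term_pos a d kmin)
  then have "1 / a k \<le> (\<Sum>j=1..r. eq_term (d j) (a j) (a k))"
    using eq_term_at_coefficient[OF a d] k(1) by simp
  then have "1 \<le> g (a k)"
    using a[OF k(1)] by (simp add: g_def field_simps)
  moreover have "g 0 \<le> 1" by (simp add: g_def)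
  ultimately obtain l where l: "0 \<le> l" "l \<le> a k" "g l = 1"
    using IVT'[of g 0 1 "a k"] cont a[OF k(1)] by (auto simp: less_imp_le)
  have "l > 0" using l by (cases "l = 0") (auto simp: g_def)
  have le: "l \<le> a j" if "j \<in> {1..r}" for j using kmin[OF that] l(2) by simp
  have "a j * real m + a j - l \<noteq> 0" if "j \<in> {1..r}" "d j = enat m" for j m
    using eq_term_denom_pos[OF a le, of j m] d[OF that(1)] that by (auto simp: one_enat_def)
  then have "is_solution r d a l"
    using \<open>l > 0\<close> l(3) by (auto simp: is_solution_def g_def field_simps)
  then show ?thesis using that \<open>l > 0\<close> le by blast
qed

lemma solution_minimal:
  assumes "r \<ge> 1" and a: "\<And>j. j \<in> {1..r} \<Longrightarrow> a j > 0" and d: "\<And>j. j \<in> {1..r} \<Longrightarrow> d j \<ge> 1"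
    and sol: "is_solution r d a l" and "l > 0" and le: "\<And>j. j \<in> {1..r} \<Longrightarrow> l \<le> a j"
    and sol': "is_solution r d a l'"
  shows "l \<le> l'"
proof (rule ccontr)
  assume "\<not> l \<le> l'"
  then have less: "l' < l" by simp
  have le': "l' \<le> a j" if "j \<in> {1..r}" for j using le[OF that] less by simp
  have "0 < (\<Sum>j=1..r. eq_term (d j) (a j) l')"
    using assms(1) by (intro sum_pos eq_term_pos a d le') auto
  then have pos: "l' > 0" using sol' by (simp add: is_solution_def)
  have "(\<Sum>j=1..r. eq_term (d j) (a j) l') \<le> (\<Sum>j=1..r. eq_term (d j) (a j) l)"
    using less by (intro sum_mono eq_term_mono a d le) auto
  then have "1 / l' \<le> 1 / l" using sol sol' by (simp add: is_solution_def)
  then show False using pos less by (simp add: field_simps)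
qed

section \<open>The solution as an infimum\<close>

lemma phi_ge:
  assumes a: "\<And>j. j \<in> {1..r} \<Longrightarrow> a j > 0" and d: "\<And>j. j \<in> {1..r} \<Longrightarrow> d j \<ge> 1"
    and sol: "is_solution r d a l" and "l > 0" and le: "\<And>j. j \<in> {1..r} \<Longrightarrow> l \<le> a j"
    and feas: "(x0, x) \<in> feasible r d"
  shows "l \<le> phi r d a x0 x"
proof -
  define t where "t = (\<lambda>j. eq_term (d j) (a j) l)"
  define s where "s = (\<lambda>j. ip (ones (d j)) (x j))"
  define S where "S = (\<Sum>j=1..r. s j)"
  have x: "x j \<in> vecs (d j)" if "j \<in> {1..r}" for j using feas that by (auto simp: feasible_def)
  have norm: "x0\<^sup>2 + (\<Sum>j=1..r. ip (x j) (x j)) = 1" and x0: "x0 = - S"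
    using feas by (auto simp: feasible_def s_def S_def)
  have tpos: "t j > 0" if "j \<in> {1..r}" for j
    unfolding t_def by (intro eq_term_pos a d le that)
  have tsum: "(\<Sum>j=1..r. t j) = 1 / l" using sol by (simp add: is_solution_def t_def)
  \<comment> \<open>Cauchy-Schwarz over the blocks: \<open>l S t\<^sub>j\<close> is the minimiser of \<open>\<Sum>\<^sub>j s\<^sub>j\<^sup>2 / t\<^sub>j\<close> with given \<open>S\<close>.\<close>
  have tangent: "2 * (l * S) * s j - (l * S)\<^sup>2 * t j \<le> (s j)\<^sup>2 / t j" if "j \<in> {1..r}" for j
  proof -
    have "0 \<le> (s j - l * S * t j)\<^sup>2 / t j" using tpos[OF that] by simp
    also have "\<dots> = (s j)\<^sup>2 / t j - 2 * (l * S) * s j + (l * S)\<^sup>2 * t j"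
      using tpos[OF that] by (simp add: power2_eq_square field_simps)
    finally show ?thesis by simp
  qed
  have "l * S\<^sup>2 = 2 * (l * S) * S - (l * S)\<^sup>2 * (\<Sum>j=1..r. t j)"
    unfolding tsum using \<open>l > 0\<close> by (simp add: power2_eq_square)
  also have "\<dots> = (\<Sum>j=1..r. 2 * (l * S) * s j - (l * S)\<^sup>2 * t j)"
    by (simp add: sum_subtractf sum_distrib_left[symmetric] S_def)
  also have "\<dots> \<le> (\<Sum>j=1..r. (s j)\<^sup>2 / t j)"
    using tangent by (intro sum_mono) auto
  also have "\<dots> \<le> (\<Sum>j=1..r. (a j - l) * ip (x j) (x j) + a j * (s j)\<^sup>2)"
    unfolding s_def t_def by (intro sum_mono block_form_ge a d le x)
  also have "\<dots> = phi r d a x0 x - l * (\<Sum>j=1..r. ip (x j) (x j))"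
    by (simp add: phi_def s_def sum.distrib sum_subtractf sum_distrib_left algebra_simps)
  finally have "l * (x0\<^sup>2 + (\<Sum>j=1..r. ip (x j) (x j))) \<le> phi r d a x0 x"
    by (simp add: x0 algebra_simps)
  then show ?thesis unfolding norm by simp
qed

text \<open>
  The constant blocks with entry sums \<open>t\<^sub>j\<close> satisfy the linear constraint with \<open>x\<^sub>0 = - (1/l)\<close>; the
  quadratic constraint is then achieved by scaling. As \<open>x\<^sub>0\<^sup>2\<close> alone contributes \<open>1/l\<^sup>2\<close> to the squared
  norm, scaling multiplies the cut-off error by at most \<open>l\<^sup>2\<close>.
\<close>

lemma phi_approx:
  fixes N :: nat
  assumes a: "\<And>j. j \<in> {1..r} \<Longrightarrow> a j > 0" and d: "\<And>j. j \<in> {1..r} \<Longrightarrow> d j \<ge> 1"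
    and sol: "is_solution r d a l" and "l > 0" and le: "\<And>j. j \<in> {1..r} \<Longrightarrow> l \<le> a j"
    and "N > 0"
  defines "C \<equiv> l\<^sup>2 * (\<Sum>j=1..r. (a j - l) * (eq_term (d j) (a j) l)\<^sup>2)"
  shows "\<exists>v\<in>{phi r d a x0 x |x0 x. (x0, x) \<in> feasible r d}. v \<le> l + C / N"
proof -
  define t where "t = (\<lambda>j. eq_term (d j) (a j) l)"
  define n where "n = (\<lambda>j. cutoff N (d j))"
  define R where "R = (1 / l)\<^sup>2 + (\<Sum>j=1..r. (t j)\<^sup>2 / n j)"
  define c where "c = 1 / sqrt R"
  define x where "x = (\<lambda>j. const_vec (n j) (c * t j / n j))"
  have npos: "n j > 0" if "j \<in> {1..r}" for j
    unfolding n_def by (intro cutoff_pos d that \<open>N > 0\<close>)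
  have tsum: "(\<Sum>j=1..r. t j) = 1 / l" using sol by (simp add: is_solution_def t_def)
  have R: "(1 / l)\<^sup>2 \<le> R" unfolding R_def by (simp add: sum_nonneg)
  have "0 < (1 / l)\<^sup>2" using \<open>l > 0\<close> by simp
  with R have Rpos: "R > 0" by linarith
  then have c2: "c\<^sup>2 = 1 / R" by (simp add: c_def power_divide)
  have ipx: "ip (x j) (x j) = c\<^sup>2 * ((t j)\<^sup>2 / n j)" if "j \<in> {1..r}" for j
    using npos[OF that] by (simp add: x_def ip_const_vec power2_eq_square field_simps)
  have sx: "ip (ones (d j)) (x j) = c * t j" if "j \<in> {1..r}" for j
    using npos[OF that] by (simp add: x_def n_def ip_ones_const_vec cutoff_le)
  have "(\<Sum>j=1..r. ip (x j) (x j)) = c\<^sup>2 * (\<Sum>j=1..r. (t j)\<^sup>2 / n j)"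
    unfolding sum_distrib_left by (intro sum.cong ipx refl)
  then have "(- c / l)\<^sup>2 + (\<Sum>j=1..r. ip (x j) (x j)) = c\<^sup>2 * R"
    by (simp add: R_def distrib_left power_divide)
  moreover have "(\<Sum>j=1..r. ip (ones (d j)) (x j)) = c * (\<Sum>j=1..r. t j)"
    unfolding sum_distrib_left by (intro sum.cong sx refl)
  moreover have "x j \<in> vecs (d j)" for j
    by (simp add: x_def n_def const_vec_in_vecs cutoff_le)
  ultimately have feas: "(- c / l, x) \<in> feasible r d"
    using Rpos unfolding tsum by (simp add: feasible_def c2)
  let ?E = "\<Sum>j=1..r. (a j - l) * (t j)\<^sup>2"
  have "phi r d a (- c / l) x = c\<^sup>2 * (\<Sum>j=1..r. a j * ((t j)\<^sup>2 / n j + (t j)\<^sup>2))"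
    unfolding phi_def sum_distrib_left
    by (intro sum.cong refl) (simp add: ipx sx power_mult_distrib distrib_left mult.left_commute)
  also have "(\<Sum>j=1..r. a j * ((t j)\<^sup>2 / n j + (t j)\<^sup>2))
      = (\<Sum>j=1..r. (a j - l) * ((t j)\<^sup>2 / n j) + a j * (t j)\<^sup>2) + l * (\<Sum>j=1..r. (t j)\<^sup>2 / n j)"
    unfolding sum_distrib_left sum.distrib[symmetric]
    by (intro sum.cong refl) (simp add: distrib_left left_diff_distrib diff_divide_distrib)
  also have "(\<Sum>j=1..r. (a j - l) * ((t j)\<^sup>2 / n j) + a j * (t j)\<^sup>2)
      \<le> (\<Sum>j=1..r. t j + (a j - l) * (t j)\<^sup>2 / N)"
    unfolding t_def n_def by (intro sum_mono const_block_form a d le \<open>N > 0\<close>)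
  also have "\<dots> = 1 / l + ?E / N"
    unfolding sum.distrib tsum by (simp add: sum_divide_distrib)
  also have "1 / l + ?E / N + l * (\<Sum>j=1..r. (t j)\<^sup>2 / n j) = l * R + ?E / N"
    using \<open>l > 0\<close> by (simp add: R_def distrib_left power2_eq_square)
  finally have "phi r d a (- c / l) x \<le> c\<^sup>2 * (l * R + ?E / N)"
    by (simp add: mult_left_mono)
  also have "\<dots> = l + (?E / N) * (1 / R)"
    using Rpos by (simp add: c2 field_simps)
  also have "(?E / N) * (1 / R) \<le> (?E / N) * l\<^sup>2"
  proof (rule mult_left_mono)
    show "1 / R \<le> l\<^sup>2" using R Rpos \<open>l > 0\<close> by (simp add: power_divide field_simps)
    show "0 \<le> ?E / N" using le by (intro divide_nonneg_nonneg sum_nonneg mult_nonneg_nonneg) auto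
  qed
  also have "(?E / N) * l\<^sup>2 = C / N" by (simp add: C_def t_def)
  finally have "phi r d a (- c / l) x \<le> l + C / N" by simp
  then show ?thesis using feas by blast
qed

lemma cond_inf_eq_solution:
  assumes a: "\<And>j. j \<in> {1..r} \<Longrightarrow> a j > 0" and d: "\<And>j. j \<in> {1..r} \<Longrightarrow> d j \<ge> 1"
    and sol: "is_solution r d a l" and "l > 0" and le: "\<And>j. j \<in> {1..r} \<Longrightarrow> l \<le> a j"
  shows "cond_inf r d a = l"
proof -
  let ?V = "{phi r d a x0 x |x0 x. (x0, x) \<in> feasible r d}"
  define C where "C = l\<^sup>2 * (\<Sum>j=1..r. (a j - l) * (eq_term (d j) (a j) l)\<^sup>2)"
  have lower: "l \<le> v" if "v \<in> ?V" for v
    using that by (auto intro!: phi_ge a d sol le \<open>l > 0\<close>)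
  have approx: "\<exists>v\<in>?V. v \<le> l + C / N" if "N > 0" for N :: nat
    unfolding C_def by (intro phi_approx a d sol le that \<open>l > 0\<close>)
  have bdd: "bdd_below ?V" using lower by (rule bdd_belowI)
  have "Inf ?V \<le> l + C / Suc N" for N
  proof -
    obtain v where "v \<in> ?V" "v \<le> l + C / Suc N" using approx[of "Suc N"] by blast
    then show ?thesis using cInf_lower[OF _ bdd] by fastforce
  qed
  moreover have "(\<lambda>N. l + C / Suc N) \<longlonglongrightarrow> l + 0"
    by (intro tendsto_add tendsto_const LIMSEQ_Suc lim_const_over_n)
  ultimately have "Inf ?V \<le> l"
    using LIMSEQ_le_const[of "\<lambda>N. l + C / Suc N" "l + 0"] by auto
  moreover have "l \<le> Inf ?V"
    using approx[of 1] lower by (intro cInf_greatest) auto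
  ultimately show ?thesis unfolding cond_inf_def by simp
qed

theorem theorem3p5:
  fixes r :: nat and d :: "nat \<Rightarrow> enat" and a :: "nat \<Rightarrow> real"
  assumes "r \<ge> 1"
    and "\<And>j. j \<in> {1..r} \<Longrightarrow> a j > 0"
    and "\<And>j. j \<in> {1..r} \<Longrightarrow> d j \<ge> 1"
  shows "is_minimal_solution r d a (cond_inf r d a)"
proof -
  obtain l where l: "is_solution r d a l" "l > 0" "\<And>j. j \<in> {1..r} \<Longrightarrow> l \<le> a j"
    using solution_exists[of r a d] assms by blast
  have "cond_inf r d a = l"
    using cond_inf_eq_solution[of r a d l] assms l by blast
  moreover have "l \<le> l'" if "is_solution r d a l'" for l'
    using solution_minimal[of r a d l l'] assms l that by blast
  ultimately show ?thesis using l(1) by (simp add: is_minimal_solution_def)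
qed

end
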